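(* Let $n\ge 2$, let $m_1,\dots,m_n>0$, and let $q_1,\dots,q_n:\mathbb{R}\to\mathbb{R}^N$ be an equally spaced choreographic solution of $$\ddot q_k=\sum_{j=1,\,j\neq k}^{n} m_j (q_j-q_k)\, f\!\left(\|q_j-q_k\|^2\right),\qquad k\in\{1,\dots,n\},$$ where $\|\cdot\|$ is the Euclidean norm and $f:\mathbb{R}_{>0}\to\mathbb{R}_{>0}$ is a positive function such that $\sqrt{x}\,f(x)$ is decreasing. If $d=n-1$, or $d=n-2$, or ($n$ is odd and $d=n-3$), then $m_1=m_2=\dots=m_n$. If $n$ is even and $d=n-3$, then all masses with an odd label are equal and all masses with an even label are equal.
   Context: A choreographic solution (choreography) is a solution $q_1,\dots,q_n$ for which there exist a twice continuously differentiable periodic function $p:\mathbb{R}\to\mathbb{R}^N$, with period $\widehat P$, and constants $h_1,\dots,h_n$ such that $q_k(t)=p(t+h_k)$ for all $k$ and $t$. It is equally spaced if $h_{k+1}-h_k$ is independent of $k$ (indices taken with $h_{k+n}=h_k+\widehat P$). The statement "$d=k$" means: there is a set $S\subset[0,\widehat P]$ of Lebesgue measure $\widehat P$ such that for every $t\in S$ the point masses $q_1(t),\dots,q_n(t)$ span a $k$-dimensional space (i.e. the difference vectors $q_j(t)-q_1(t)$, $j=2,\dots,n$, span a $k$-dimensional subspace). *)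

theory Defs
  imports "HOL-Analysis.Analysis"
begin

definition C2_fun :: "(real \<Rightarrow> 'a::real_normed_vector) \<Rightarrow> bool" where
  "C2_fun p \<longleftrightarrow> (\<exists>p' p''. (\<forall>t. (p has_vector_derivative p' t) (at t)) \<and>
                         (\<forall>t. (p' has_vector_derivative p'' t) (at t)) \<and>
                         continuous_on UNIV p'')"

definition choreography ::
  "nat \<Rightarrow> (nat \<Rightarrow> real \<Rightarrow> 'a::real_normed_vector) \<Rightarrow> (real \<Rightarrow> 'a) \<Rightarrow> real \<Rightarrow> (nat \<Rightarrow> real) \<Rightarrow> bool" where
  "choreography n q p P h \<longleftrightarrow> C2_fun p \<and> P > 0 \<and> (\<forall>t. p (t + P) = p t) \<and>
     (\<forall>k\<in>{1..n}. \<forall>t. q k t = p (t + h k))"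

text \<open>Equally spaced: h_{k+1} - h_k independent of k, with h_{n+1} = h_1 + P.\<close>
definition equally_spaced :: "nat \<Rightarrow> real \<Rightarrow> (nat \<Rightarrow> real) \<Rightarrow> bool" where
  "equally_spaced n P h \<longleftrightarrow> (\<exists>c. (\<forall>k\<in>{1..<n}. h (k + 1) - h k = c) \<and> (h 1 + P) - h n = c)"

text \<open>Solution of  q_k'' = sum_{j \<noteq> k} m_j (q_j - q_k) f(|q_j - q_k|^2),  k = 1..n,
  collision-free (so that f is evaluated only at positive arguments), for all times t.\<close>
definition is_solution ::
  "nat \<Rightarrow> (nat \<Rightarrow> real) \<Rightarrow> (real \<Rightarrow> real) \<Rightarrow> (nat \<Rightarrow> real \<Rightarrow> 'a::real_normed_vector) \<Rightarrow> bool" where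
  "is_solution n m f q \<longleftrightarrow>
     (\<forall>t. \<forall>j\<in>{1..n}. \<forall>k\<in>{1..n}. j \<noteq> k \<longrightarrow> q j t \<noteq> q k t) \<and>
     (\<forall>k\<in>{1..n}. \<exists>v a. (\<forall>t. (q k has_vector_derivative v t) (at t)) \<and>
                        (\<forall>t. (v has_vector_derivative a t) (at t)) \<and>
                        (\<forall>t. a t = (\<Sum>j\<in>{1..n} - {k}.
                              (m j * f ((norm (q j t - q k t))\<^sup>2)) *\<^sub>R (q j t - q k t))))"

definition config_dim ::
  "nat \<Rightarrow> (nat \<Rightarrow> real \<Rightarrow> 'a::euclidean_space) \<Rightarrow> real \<Rightarrow> nat \<Rightarrow> bool" where
  "config_dim n q P d \<longleftrightarrow> (\<exists>S. S \<subseteq> {0..P} \<and> S \<in> sets lebesgue \<and> emeasure lebesgue S = ennreal P \<and>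
      (\<forall>t\<in>S. dim (span ((\<lambda>j. q j t - q 1 t) ` {2..n})) = d))"

end

theory Submission
  imports Defs
begin

text \<open>Number the bodies $0,\dots,n-1$ cyclically, so that $x_j(t+c) = x_{j+1}(t)$ with $nc = P$.
  Reading the equation of body $k$ at time $t$ as an equation for body $0$ at a shifted time gives
  $n$ expressions for the same acceleration; subtracting them shows that the mass increments
  $a_j = m_{j+1} - m_j$ satisfy $\sum_j a_{j+l}\, w_{jk}\,(x_j - x_k) = 0$ for all $k, l, t$, where
  $w_{jk} = f(\|x_j - x_k\|^2)$. For $d = n-1-r$ any $r+1$ of these relations are linearly
  dependent, which forces a short recurrence on $a$ and, except in degenerate cases, the ratio
  $w_{j0}/w_{j1}$ to be independent of $j$. Then at almost every time, hence by continuity at every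
  time, one of the bodies $0, 1$ is at least as close as the other to every third body. The moments $\sum_j \|x_j - x_k\|^2$ of the two bodies
  coincide at some time, by the intermediate value theorem, and at that time all third bodies are
  equidistant from both. Adding the relations of the two bodies and projecting to $x_1 - x_0$ then
  leaves $a_{l+1} = a_l$.\<close>

section \<open>Linear relations and periodic sequences\<close>

text \<open>The relations among the \<open>y i\<close> form a space of dimension
  \<open>card I\<close> minus the rank of the family, hence at most \<open>r\<close>, so
  \<open>r + 1\<close> of them are dependent. The induction is Gaussian elimination: an index with
  nonzero coefficient in the last relation is removed without lowering the rank.\<close>

lemma relations_dependent:
  fixes y :: "'i \<Rightarrow> 'a::euclidean_space" and C :: "nat \<Rightarrow> 'i \<Rightarrow> real"
  assumes "finite I" "card I \<le> r + dim (y ` I)"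
    and "\<forall>k\<le>r. (\<Sum>i\<in>I. C k i *\<^sub>R y i) = 0"
  shows "\<exists>\<alpha>. (\<exists>k\<le>r. \<alpha> k \<noteq> 0) \<and> (\<forall>i\<in>I. (\<Sum>k\<le>r. \<alpha> k * C k i) = 0)"
  using assms
proof (induction r arbitrary: I C)
  have redundant: "dim (y ` I) = dim (y ` (I - {i0}))"
    if "finite I" "i0 \<in> I" "c i0 \<noteq> 0" "(\<Sum>i\<in>I. c i *\<^sub>R y i) = 0" for I and c :: "'i \<Rightarrow> real" and i0
  proof -
    have "c i0 *\<^sub>R y i0 = - (\<Sum>i\<in>I - {i0}. c i *\<^sub>R y i)"
      using that by (simp add: sum.remove[of I i0] eq_neg_iff_add_eq_0)
    then have "y i0 = (1 / c i0) *\<^sub>R (- (\<Sum>i\<in>I - {i0}. c i *\<^sub>R y i))"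
      using that(3) by (metis divideR_right inverse_eq_divide)
    moreover have "\<dots> \<in> span (y ` (I - {i0}))"
      by (intro span_scale span_neg span_sum span_base) auto
    ultimately have "y i0 \<in> span (y ` (I - {i0}))" by simp
    then have "span (insert (y i0) (y ` (I - {i0}))) = span (y ` (I - {i0}))"
      by (rule span_redundant)
    moreover have "insert (y i0) (y ` (I - {i0})) = y ` I" using that by auto
    ultimately show ?thesis by (metis dim_span)
  qed
  {
    case 0
    have "C 0 i = 0" if "i \<in> I" for i
    proof (rule ccontr)
      assume "C 0 i \<noteq> 0"
      then have "dim (y ` I) = dim (y ` (I - {i}))"
        using redundant[of I i "C 0"] 0 that by auto
      also have "\<dots> \<le> card (y ` (I - {i}))" using 0 by (intro dim_le_card') auto
      also have "\<dots> \<le> card (I - {i})" using 0 by (intro card_image_le) auto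
      also have "\<dots> < card I" using 0 that by (intro psubset_card_mono) auto
      finally show False using 0 by simp
    qed
    then show ?case by (intro exI[of _ "\<lambda>_. 1"]) auto
  next
    case (Suc r)
    show ?case
    proof (cases "\<forall>i\<in>I. C (Suc r) i = 0")
      case True
      then show ?thesis
        by (intro exI[of _ "\<lambda>k. if k = Suc r then 1 else 0"]) (auto simp: if_distrib)
    next
      case False
      then obtain i0 where i0: "i0 \<in> I" "C (Suc r) i0 \<noteq> 0" by blast
      define g where "g k = C k i0 / C (Suc r) i0" for k
      define C' where "C' k i = C k i - g k * C (Suc r) i" for k i
      have C'0: "C' k i0 = 0" for k using i0 by (simp add: C'_def g_def)
      have rel: "(\<Sum>i\<in>I. C' k i *\<^sub>R y i) = 0" if "k \<le> r" for k
      proof -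
        have "(\<Sum>i\<in>I. C' k i *\<^sub>R y i) = (\<Sum>i\<in>I. C k i *\<^sub>R y i) - g k *\<^sub>R (\<Sum>i\<in>I. C (Suc r) i *\<^sub>R y i)"
          by (simp add: C'_def algebra_simps sum_subtractf scaleR_sum_right)
        then show ?thesis using Suc.prems(3) that by simp
      qed
      have rel': "\<forall>k\<le>r. (\<Sum>i\<in>I - {i0}. C' k i *\<^sub>R y i) = 0"
        using rel i0(1) Suc.prems(1) C'0 by (simp add: sum.remove[of I i0])
      have "dim (y ` I) = dim (y ` (I - {i0}))"
        using redundant[of I i0 "C (Suc r)"] Suc.prems i0 by blast
      then have "card (I - {i0}) \<le> r + dim (y ` (I - {i0}))"
        using Suc.prems i0 by simp
      from Suc.IH[OF _ this rel'] Suc.prems(1) obtain \<alpha> where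
        \<alpha>: "\<exists>k\<le>r. \<alpha> k \<noteq> 0" "\<forall>i\<in>I - {i0}. (\<Sum>k\<le>r. \<alpha> k * C' k i) = 0" by auto
      have \<alpha>': "(\<Sum>k\<le>r. \<alpha> k * C' k i) = 0" if "i \<in> I" for i
        using \<alpha>(2) C'0 that by (cases "i = i0") auto
      \<comment> \<open>The last coefficient supplies the multiples of relation \<open>Suc r\<close>
        that were subtracted in forming \<open>C'\<close>.\<close>
      define \<beta> where "\<beta> k = (if k = Suc r then - (\<Sum>k\<le>r. \<alpha> k * g k) else \<alpha> k)" for k
      have "(\<Sum>k\<le>Suc r. \<beta> k * C k i) = (\<Sum>k\<le>r. \<alpha> k * C' k i)" for i
        by (simp add: \<beta>_def C'_def algebra_simps sum_subtractf sum_distrib_left sum_distrib_right)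
      moreover obtain k where "k \<le> r" "\<alpha> k \<noteq> 0" using \<alpha>(1) by blast
      then have "k \<le> Suc r" "\<beta> k \<noteq> 0" by (auto simp: \<beta>_def)
      ultimately show ?thesis using \<alpha>' by metis
    qed
  }
qed

lemma sum_periodic_shift:
  fixes g :: "nat \<Rightarrow> 'a::ab_group_add"
  assumes "\<And>j. g (j + n) = g j"
  shows "(\<Sum>j<n. g (j + l)) = (\<Sum>j<n. g j)"
proof (induction l)
  case (Suc l)
  have "(\<Sum>j<n. g (j + Suc l)) + g l = (\<Sum>j<Suc n. g (j + l))"
    by (simp add: sum.lessThan_Suc_shift del: sum.lessThan_Suc)
  also have "\<dots> = (\<Sum>j<n. g (j + l)) + g l"
    using assms[of l] by (simp add: add.commute)
  finally show ?case using Suc by simp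
qed simp

lemma periodic_mod:
  fixes g :: "nat \<Rightarrow> 'a"
  assumes "\<And>j. g (j + n) = g j"
  shows "g (j mod n) = g j"
proof -
  have "g (i + k * n) = g i" for i k
  proof (induction k)
    case (Suc k)
    then show ?case using assms[of "i + k * n"] by (simp add: algebra_simps)
  qed simp
  then show ?thesis by (metis mod_mult_div_eq add.commute mult.commute)
qed

text \<open>The sum of squares over a period is positive and invariant under shifts, but a shift by
  \<open>s\<close> multiplies it by the square of \<rho>.\<close>

lemma cyclic_multiplier:
  fixes a :: "nat \<Rightarrow> real"
  assumes per: "\<And>j. a (j + n) = a j" and n: "n > 0" and s: "s > 0"
    and rec: "\<And>i. a (i + s) = \<rho> * a i" and nz: "a i \<noteq> 0"
  shows "\<rho> = 1 \<or> \<rho> = -1"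
proof -
  have "(\<Sum>j<n. (a (j + s))\<^sup>2) = (\<Sum>j<n. (a j)\<^sup>2)"
    using sum_periodic_shift[of "\<lambda>j. (a j)\<^sup>2" n s] per by simp
  moreover have "(\<Sum>j<n. (a (j + s))\<^sup>2) = \<rho>\<^sup>2 * (\<Sum>j<n. (a j)\<^sup>2)"
    by (simp add: rec power_mult_distrib sum_distrib_left)
  moreover have "(\<Sum>j<n. (a j)\<^sup>2) > 0"
  proof (rule sum_pos2)
    show "i mod n \<in> {..<n}" using n by simp
    show "0 < (a (i mod n))\<^sup>2" using periodic_mod[of a n i] per nz by simp
  qed auto
  ultimately have "\<rho>\<^sup>2 = 1" by simp
  then show ?thesis by (simp add: power2_eq_1_iff)
qed

section \<open>Equally spaced orbits\<close>

text \<open>The index is continued periodically to all naturals, so that a shift in time by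
  \<open>c\<close> is a shift of the index by one. The masses stay outside: they enter only through
  balanced sequences.\<close>

locale equally_spaced_orbit =
  fixes n :: nat and c :: real and f :: "real \<Rightarrow> real"
    and x :: "nat \<Rightarrow> real \<Rightarrow> 'a::euclidean_space"
  assumes n2: "n \<ge> 2" and c_pos: "c > 0"
    and f_pos: "\<And>s. s > 0 \<Longrightarrow> f s > 0"
    and f_decr: "\<And>s s'. 0 < s \<Longrightarrow> s < s' \<Longrightarrow> f s' < f s"
    and cont: "\<And>j. continuous_on UNIV (x j)"
    and shift1: "\<And>j t. x j (t + c) = x (Suc j) t"
    and periodic: "\<And>j t. x (j + n) t = x j t"
    and collision_free: "\<And>j k t. j < n \<Longrightarrow> k < n \<Longrightarrow> j \<noteq> k \<Longrightarrow> x j t \<noteq> x k t"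
begin

definition w :: "nat \<Rightarrow> nat \<Rightarrow> real \<Rightarrow> real" where
  "w j k t = f ((norm (x j t - x k t))\<^sup>2)"

text \<open>The sum includes $j = 0$, where the weight is the junk value \<open>f 0\<close>; the term vanishes
  because the difference vector does.\<close>
definition balanced :: "(nat \<Rightarrow> real) \<Rightarrow> bool" where
  "balanced a \<longleftrightarrow> (\<forall>j. a (j + n) = a j) \<and> (\<Sum>j<n. a j) = 0 \<and>
     (\<forall>l t. (\<Sum>j<n. (a (j + l) * w j 0 t) *\<^sub>R (x j t - x 0 t)) = 0)"

lemma shift: "x j (t + real l * c) = x (j + l) t"
proof (induction l arbitrary: t)
  case (Suc l)
  have "x j (t + real (Suc l) * c) = x j ((t + c) + real l * c)" by (simp add: algebra_simps)
  then show ?case using Suc[of "t + c"] shift1[of "j + l" t] by simp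
qed simp

lemma w_sym: "w j k t = w k j t"
  by (simp add: w_def norm_minus_commute)

lemma w_pos: "j < n \<Longrightarrow> k < n \<Longrightarrow> j \<noteq> k \<Longrightarrow> w j k t > 0"
  using collision_free[of j k t] by (auto simp: w_def intro!: f_pos)

lemma w_periodic: "w (j + n) k t = w j k t"
  by (simp add: w_def periodic)

lemma w_shift: "w j k (t + real l * c) = w (j + l) (k + l) t"
  by (simp add: w_def shift)

lemma dist_le_of_w_ge:
  assumes "i < n" "j < n" "k < n" "i \<noteq> j" "i \<noteq> k" "w i j t \<ge> w i k t"
  shows "norm (x i t - x j t) \<le> norm (x i t - x k t)"
proof (rule ccontr)
  assume "\<not> ?thesis"
  then have "(norm (x i t - x k t))\<^sup>2 < (norm (x i t - x j t))\<^sup>2"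
    by (intro power_strict_mono) auto
  moreover have "0 < (norm (x i t - x k t))\<^sup>2" using collision_free[of i k t] assms by auto
  ultimately have "w i j t < w i k t" unfolding w_def by (intro f_decr)
  with assms show False by simp
qed

section \<open>Balanced sequences: change of body, shifts and linear combinations\<close>

lemma balanced_periodic: "balanced a \<Longrightarrow> a (j + n) = a j"
  by (simp add: balanced_def)

lemma balanced_sum: "balanced a \<Longrightarrow> (\<Sum>j<n. a (j + l)) = 0"
  using sum_periodic_shift[of a n l] by (simp add: balanced_def)

text \<open>Body \<open>k\<close> at time \<open>t\<close> stands where body 0 stands at time
  \<open>t + k * c\<close>, so this is the relation of body 0 at that time with lag
  \<open>k + l\<close>.\<close>

lemma balanced_at:
  assumes "balanced a"
  shows "(\<Sum>j<n. (a (j + l) * w j k t) *\<^sub>R (x j t - x k t)) = 0"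
proof -
  let ?g = "\<lambda>j. (a (j + l) * w j k t) *\<^sub>R (x j t - x k t)"
  have "a (j + n + l) = a (j + l)" for j
    using balanced_periodic[OF assms, of "j + l"] by (simp add: algebra_simps)
  then have "(\<Sum>j<n. ?g j) = (\<Sum>j<n. ?g (j + k))"
    by (intro sum_periodic_shift[symmetric]) (simp add: w_periodic periodic)
  also have "\<dots> = (\<Sum>j<n. (a (j + (k + l)) * w j 0 (t + real k * c)) *\<^sub>R
                        (x j (t + real k * c) - x 0 (t + real k * c)))"
    by (simp add: w_shift shift add.assoc)
  also have "\<dots> = 0" using assms by (simp add: balanced_def)
  finally show ?thesis .
qed

text \<open>Allows \<open>a\<close> to be replaced by combinations of its shifts with better
  symmetry or with zeros at prescribed places.\<close>

lemma balanced_comb: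
  assumes "balanced a"
  shows "balanced (\<lambda>j. \<alpha> * a (j + s) + \<beta> * a (j + s'))"
proof -
  have "(\<Sum>j<n. ((\<alpha> * a (j + l + s) + \<beta> * a (j + l + s')) * w j 0 t) *\<^sub>R (x j t - x 0 t)) = 0" for l t
  proof -
    let ?y = "\<lambda>j. w j 0 t *\<^sub>R (x j t - x 0 t)"
    have "(\<Sum>j<n. ((\<alpha> * a (j + l + s) + \<beta> * a (j + l + s')) * w j 0 t) *\<^sub>R (x j t - x 0 t))
        = (\<Sum>j<n. \<alpha> *\<^sub>R (a (j + (l + s)) *\<^sub>R ?y j) + \<beta> *\<^sub>R (a (j + (l + s')) *\<^sub>R ?y j))"
      by (intro sum.cong refl) (simp only: scaleR_add_left distrib_right scaleR_scaleR mult.assoc add.assoc)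
    also have "\<dots> = \<alpha> *\<^sub>R (\<Sum>j<n. (a (j + (l + s)) * w j 0 t) *\<^sub>R (x j t - x 0 t))
        + \<beta> *\<^sub>R (\<Sum>j<n. (a (j + (l + s')) * w j 0 t) *\<^sub>R (x j t - x 0 t))"
      by (simp only: sum.distrib scaleR_sum_right scaleR_scaleR)
    finally have "(\<Sum>j<n. ((\<alpha> * a (j + l + s) + \<beta> * a (j + l + s')) * w j 0 t) *\<^sub>R (x j t - x 0 t))
        = \<dots>" .
    then show ?thesis by (simp only: balanced_at[OF assms]) simp
  qed
  moreover have "(\<Sum>j<n. \<alpha> * a (j + s) + \<beta> * a (j + s')) = 0"
    by (simp add: sum.distrib balanced_sum[OF assms] flip: sum_distrib_left)
  moreover have "a (j + n + s) = a (j + s)" for j s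
    using balanced_periodic[OF assms, of "j + s"] by (simp add: algebra_simps)
  ultimately show ?thesis by (simp add: balanced_def)
qed

text \<open>The diagonal entry makes the coefficients sum to zero, so that the relation no longer refers
  to the base point \<open>x k t\<close> and relations of different bodies become comparable.\<close>
definition rel :: "(nat \<Rightarrow> real) \<Rightarrow> nat \<Rightarrow> nat \<Rightarrow> real \<Rightarrow> nat \<Rightarrow> real" where
  "rel a k s t i =
     (if i = k then - (\<Sum>j\<in>{..<n} - {k}. a (j + s) * w j k t) else a (i + s) * w i k t)"

lemma rel_sum: "k < n \<Longrightarrow> (\<Sum>i<n. rel a k s t i) = 0"
  by (simp add: rel_def sum.remove[of "{..<n}" k])

lemma rel_affine:
  assumes "balanced a" "k < n"
  shows "(\<Sum>i\<in>{1..<n}. rel a k s t i *\<^sub>R (x i t - x 0 t)) = 0"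
proof -
  have "(\<Sum>i\<in>{1..<n}. rel a k s t i *\<^sub>R (x i t - x 0 t))
      = (\<Sum>i<n. rel a k s t i *\<^sub>R (x i t - x 0 t))"
    by (rule sum.mono_neutral_left) (auto simp: not_le less_Suc_eq_0_disj)
  also have "\<dots> = (\<Sum>i<n. rel a k s t i *\<^sub>R (x i t - x k t)) + (\<Sum>i<n. rel a k s t i) *\<^sub>R (x k t - x 0 t)"
    by (simp add: algebra_simps scaleR_sum_left sum.distrib sum_subtractf)
  also have "\<dots> = (\<Sum>i<n. rel a k s t i *\<^sub>R (x i t - x k t))"
    using rel_sum[OF assms(2)] by simp
  also have "\<dots> = (\<Sum>i<n. (a (i + s) * w i k t) *\<^sub>R (x i t - x k t))"
    by (rule sum.cong) (auto simp: rel_def)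
  finally show ?thesis using balanced_at[OF assms(1)] by simp
qed

text \<open>The difference vectors miss full rank \<open>n - 1\<close> by at most \<open>r\<close>.
  As an inequality, the case \<open>r = 1\<close> serves both d = n-1 and d = n-2.\<close>

definition corank_le :: "real \<Rightarrow> nat \<Rightarrow> bool" where
  "corank_le t r \<longleftrightarrow> n - 1 \<le> r + dim ((\<lambda>i. x i t - x 0 t) ` {1..<n})"

text \<open>\<open>relations_dependent\<close> yields the identity for the indices from 1 on; at
  index 0 it follows because the entries of each relation sum to zero.\<close>

lemma rel_dependent:
  assumes "\<And>k. k \<le> r \<Longrightarrow> balanced (A k)" "\<And>k. k \<le> r \<Longrightarrow> K k < n" "corank_le t r"
  shows "\<exists>\<alpha>. (\<exists>k\<le>r. \<alpha> k \<noteq> 0) \<and> (\<forall>i<n. (\<Sum>k\<le>r. \<alpha> k * rel (A k) (K k) (s k) t i) = 0)"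
proof -
  have "\<exists>\<alpha>. (\<exists>k\<le>r. \<alpha> k \<noteq> 0) \<and> (\<forall>i\<in>{1..<n}. (\<Sum>k\<le>r. \<alpha> k * rel (A k) (K k) (s k) t i) = 0)"
  proof (rule relations_dependent)
    show "card {1..<n} \<le> r + dim ((\<lambda>i. x i t - x 0 t) ` {1..<n})"
      using assms(3) by (simp add: corank_le_def)
  qed (use assms rel_affine in auto)
  then obtain \<alpha> where \<alpha>: "\<exists>k\<le>r. \<alpha> k \<noteq> 0"
    "\<forall>i\<in>{1..<n}. (\<Sum>k\<le>r. \<alpha> k * rel (A k) (K k) (s k) t i) = 0" by blast
  let ?g = "\<lambda>i. (\<Sum>k\<le>r. \<alpha> k * rel (A k) (K k) (s k) t i)"
  have "(\<Sum>i<n. ?g i) = (\<Sum>k\<le>r. \<alpha> k * (\<Sum>i<n. rel (A k) (K k) (s k) t i))"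
    by (subst sum.swap) (simp add: sum_distrib_left)
  then have "(\<Sum>i<n. ?g i) = 0" using assms(2) by (simp add: rel_sum)
  moreover have "{..<n} - {0} = {1..<n}" by auto
  then have "(\<Sum>i<n. ?g i) = ?g 0 + (\<Sum>i\<in>{1..<n}. ?g i)"
    using n2 by (subst sum.remove[of "{..<n}" 0]) auto
  moreover have "(\<Sum>i\<in>{1..<n}. ?g i) = 0" using \<alpha>(2) by (intro sum.neutral) blast
  ultimately have "?g 0 = 0" by simp
  then have "\<forall>i<n. ?g i = 0" using \<alpha>(2) by (metis One_nat_def atLeastLessThan_iff less_one linorder_not_less)
  with \<alpha>(1) show ?thesis by blast
qed

lemma rel_dependent2:
  assumes "balanced a" "k0 < n" "k1 < n" "corank_le t 1"
  obtains \<alpha> \<beta> where "\<alpha> \<noteq> 0 \<or> \<beta> \<noteq> 0"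
    "\<And>i. i < n \<Longrightarrow> \<alpha> * rel a k0 s0 t i + \<beta> * rel a k1 s1 t i = 0"
proof -
  define K s where "K = (\<lambda>i. if i = (0::nat) then k0 else k1)"
    and "s = (\<lambda>i. if i = (0::nat) then s0 else s1)"
  have "\<exists>\<alpha>. (\<exists>k\<le>1. \<alpha> k \<noteq> 0) \<and> (\<forall>i<n. (\<Sum>k\<le>1. \<alpha> k * rel a (K k) (s k) t i) = 0)"
    using assms by (intro rel_dependent) (auto simp: K_def)
  then obtain \<alpha> where \<alpha>: "\<exists>k\<le>1. \<alpha> k \<noteq> 0" "\<forall>i<n. (\<Sum>k\<le>1. \<alpha> k * rel a (K k) (s k) t i) = 0"
    by blast
  show ?thesis
  proof (rule that[of "\<alpha> 0" "\<alpha> 1"])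
    show "\<alpha> 0 \<noteq> 0 \<or> \<alpha> 1 \<noteq> 0" using \<alpha>(1) by (auto simp: le_Suc_eq)
    show "\<alpha> 0 * rel a k0 s0 t i + \<alpha> 1 * rel a k1 s1 t i = 0" if "i < n" for i
      using \<alpha>(2) that by (auto simp: K_def s_def)
  qed
qed

lemma rel_dependent3:
  assumes "balanced a" "k0 < n" "k1 < n" "k2 < n" "corank_le t 2"
  obtains \<alpha> \<beta> \<gamma> where "\<alpha> \<noteq> 0 \<or> \<beta> \<noteq> 0 \<or> \<gamma> \<noteq> 0"
    "\<And>i. i < n \<Longrightarrow> \<alpha> * rel a k0 s0 t i + \<beta> * rel a k1 s1 t i + \<gamma> * rel a k2 s2 t i = 0"
proof -
  define K s where "K = (\<lambda>i. if i = (0::nat) then k0 else if i = 1 then k1 else k2)"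
    and "s = (\<lambda>i. if i = (0::nat) then s0 else if i = 1 then s1 else s2)"
  have "\<exists>\<alpha>. (\<exists>k\<le>2. \<alpha> k \<noteq> 0) \<and> (\<forall>i<n. (\<Sum>k\<le>2. \<alpha> k * rel a (K k) (s k) t i) = 0)"
    using assms by (intro rel_dependent) (auto simp: K_def)
  then obtain \<alpha> where \<alpha>: "\<exists>k\<le>2. \<alpha> k \<noteq> 0" "\<forall>i<n. (\<Sum>k\<le>2. \<alpha> k * rel a (K k) (s k) t i) = 0"
    by blast
  show ?thesis
  proof (rule that[of "\<alpha> 0" "\<alpha> 1" "\<alpha> 2"])
    show "\<alpha> 0 \<noteq> 0 \<or> \<alpha> 1 \<noteq> 0 \<or> \<alpha> 2 \<noteq> 0" using \<alpha>(1) by (auto simp: le_Suc_eq numeral_2_eq_2)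
    show "\<alpha> 0 * rel a k0 s0 t i + \<alpha> 1 * rel a k1 s1 t i + \<alpha> 2 * rel a k2 s2 t i = 0" if "i < n" for i
      using \<alpha>(2) that by (auto simp: K_def s_def numeral_2_eq_2)
  qed
qed


section \<open>Bodies with proportional weights\<close>

text \<open>All bodies count with weight one rather than with their masses; a shift in time then
  only permutes the moments.\<close>

definition moment :: "nat \<Rightarrow> real \<Rightarrow> real" where
  "moment k t = (\<Sum>i<n. (norm (x i t - x k t))\<^sup>2)"

lemma moment_shift: "moment k (t + real l * c) = moment (k + l) t"
proof -
  have "moment k (t + real l * c) = (\<Sum>i<n. (norm (x (i + l) t - x (k + l) t))\<^sup>2)"
    by (simp add: moment_def shift)
  also have "\<dots> = moment (k + l) t"
    unfolding moment_def
    by (rule sum_periodic_shift[of "\<lambda>i. (norm (x i t - x (k + l) t))\<^sup>2"]) (simp add: periodic)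
  finally show ?thesis .
qed

lemma moment_mult_n: "moment (k * n) t = moment 0 t"
proof (induction k)
  case (Suc k)
  then show ?case using periodic[of "k * n"] by (simp add: moment_def add.commute)
qed simp

text \<open>At the times \<open>k * e * c\<close> the differences of the two moments telescope
  around the cycle to zero, so the difference takes both signs or vanishes, and continuity gives a
  zero.\<close>

lemma ex_equal_moments: "\<exists>t. moment e t = moment 0 t"
proof -
  define g where "g t = moment e t - moment 0 t" for t
  have tele: "(\<Sum>k<n. g (real (k * e) * c)) = 0"
  proof -
    have "g (real (k * e) * c) = moment (Suc k * e) 0 - moment (k * e) 0" for k
      using moment_shift[of e 0 "k * e"] moment_shift[of 0 0 "k * e"] by (simp add: g_def)
    then have "(\<Sum>k<n. g (real (k * e) * c)) = moment (n * e) 0 - moment (0 * e) 0"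
      by (simp only: sum_lessThan_telescope[of "\<lambda>k. moment (k * e) 0"])
    then show ?thesis using moment_mult_n[of e 0] by (simp add: mult.commute)
  qed
  have "continuous_on UNIV g"
    unfolding g_def moment_def by (intro continuous_intros cont)
  then have conn: "connected (range g)" by (intro connected_continuous_image) auto
  have "\<exists>t. g t \<le> 0"
  proof (rule ccontr)
    assume "\<not> ?thesis"
    then have "(\<Sum>k<n. g (real (k * e) * c)) > 0" using n2
      by (intro sum_pos) (auto simp: not_le lessThan_empty_iff)
    with tele show False by simp
  qed
  moreover have "\<exists>t. g t \<ge> 0"
  proof (rule ccontr)
    assume "\<not> ?thesis"
    then have "(\<Sum>k<n. - g (real (k * e) * c)) > 0" using n2
      by (intro sum_pos) (auto simp: not_le lessThan_empty_iff)
    with tele show False by (simp add: sum_negf)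
  qed
  ultimately have "0 \<in> range g" using connectedD_interval[OF conn] by blast
  then obtain t where "g t = 0" by force
  then show ?thesis unfolding g_def by auto
qed

text \<open>The rank is controlled only within one period, while the time from
  \<open>ex_equal_moments\<close> may lie anywhere.\<close>

lemma period_reduce:
  obtains t0 where "t0 \<in> {0..real n * c}" "\<And>j. x j t = x j t0"
proof -
  define T where "T = real n * c"
  have T: "T > 0" using n2 c_pos by (simp add: T_def)
  have per: "x j (s + T) = x j s" for j s using shift[of j s n] periodic by (simp add: T_def)
  have nat: "x j (s + real k * T) = x j s" for j k s
  proof (induction k)
    case (Suc k)
    then show ?case using per[of j "s + real k * T"] by (simp add: algebra_simps)
  qed simp
  have int: "x j (s + of_int k * T) = x j s" for j k s
  proof (cases "k \<ge> 0")
    case True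
    then show ?thesis using nat[of j s "nat k"] by simp
  next
    case False
    then show ?thesis using nat[of j "s + of_int k * T" "nat (- k)"] by (simp add: algebra_simps)
  qed
  define t0 where "t0 = t + of_int (- \<lfloor>t / T\<rfloor>) * T"
  have "t0 = T * frac (t / T)" using T by (simp add: t0_def frac_def field_simps)
  then have "t0 \<in> {0..T}"
    using T frac_lt_1[of "t / T"] frac_ge_0[of "t / T"] by (auto simp: mult_le_cancel_left1)
  moreover have "x j t = x j t0" for j unfolding t0_def int ..
  ultimately show ?thesis using that T_def by blast
qed

text \<open>The non-strict inequality makes the condition closed in \<open>t\<close>, so it passes
  from a dense set of times to all times of a period.\<close>

definition closer :: "nat \<Rightarrow> nat \<Rightarrow> real \<Rightarrow> bool" where
  "closer j k t \<longleftrightarrow> (\<forall>i<n. i \<noteq> j \<longrightarrow> i \<noteq> k \<longrightarrow> norm (x i t - x j t) \<le> norm (x i t - x k t))"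

lemma closed_closer: "closed {t. closer j k t}"
proof -
  have "{t. closer j k t} =
      (\<Inter>i\<in>{i. i < n \<and> i \<noteq> j \<and> i \<noteq> k}. {t. norm (x i t - x j t) \<le> norm (x i t - x k t)})"
    by (auto simp: closer_def)
  also have "closed \<dots>"
    by (intro closed_INT ballI closed_Collect_le continuous_intros cont)
  finally show ?thesis .
qed

text \<open>The mutual distance of \<open>j\<close> and \<open>k\<close> occurs in both moments and
  cancels; the remaining sums agree and are ordered term by term, so the terms agree.\<close>

lemma closer_equal:
  assumes "closer j k t" "moment j t = moment k t" "j < n" "k < n" "i < n" "i \<noteq> j" "i \<noteq> k"
  shows "norm (x i t - x j t) = norm (x i t - x k t)"
proof -
  let ?J = "{..<n} - {j} - {k}"
  have jk: "j \<noteq> k \<Longrightarrow> moment j t = (norm (x k t - x j t))\<^sup>2 + (\<Sum>i\<in>?J. (norm (x i t - x j t))\<^sup>2)"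
    "j \<noteq> k \<Longrightarrow> moment k t = (norm (x j t - x k t))\<^sup>2 + (\<Sum>i\<in>?J. (norm (x i t - x k t))\<^sup>2)"
    using assms by (simp_all add: moment_def sum.remove[of "{..<n}" j] sum.remove[of "{..<n} - {j}" k])
  show ?thesis
  proof (cases "j = k")
    case False
    have "(\<Sum>i\<in>?J. (norm (x i t - x k t))\<^sup>2 - (norm (x i t - x j t))\<^sup>2) = 0"
      using jk[OF False] assms(2) by (simp add: sum_subtractf norm_minus_commute)
    moreover have "\<forall>i\<in>?J. (norm (x i t - x k t))\<^sup>2 - (norm (x i t - x j t))\<^sup>2 \<ge> 0"
      using assms(1) by (auto simp: closer_def intro!: power_mono)
    ultimately have "(norm (x i t - x k t))\<^sup>2 - (norm (x i t - x j t))\<^sup>2 = 0"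
      using assms by (subst (asm) sum_nonneg_eq_0_iff) auto
    then show ?thesis by (simp add: power2_eq_iff_nonneg)
  qed simp
qed

text \<open>Otherwise some body \<open>i\<close> is strictly nearer to \<open>e\<close> and some
  \<open>j\<close> strictly nearer to 0. As \<open>f\<close> decreases, the ratio of the weights
  towards 0 and \<open>e\<close> is below one for \<open>i\<close> and above one for
  \<open>j\<close>, although it is constant.\<close>

lemma ratio_const_closer:
  assumes e: "0 < e" "e < n"
    and ratio: "\<And>i j. i < n \<Longrightarrow> j < n \<Longrightarrow> i \<notin> {0, e} \<Longrightarrow> j \<notin> {0, e} \<Longrightarrow>
      w i 0 t * w j e t = w j 0 t * w i e t"
  shows "closer 0 e t \<or> closer e 0 t"
proof (rule ccontr)
  assume "\<not> ?thesis"
  then obtain i j where i: "i < n" "i \<notin> {0, e}" "norm (x i t - x 0 t) > norm (x i t - x e t)"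
    and j: "j < n" "j \<notin> {0, e}" "norm (x j t - x e t) > norm (x j t - x 0 t)"
    by (auto simp: closer_def not_le)
  have "\<not> w i e t \<le> w i 0 t" using dist_le_of_w_ge[of i 0 e t] i e by auto
  moreover have "\<not> w j 0 t \<le> w j e t" using dist_le_of_w_ge[of j e 0 t] j e by auto
  moreover have "w i 0 t > 0" "w j e t > 0" using w_pos i j e by auto
  ultimately have "w i 0 t * w j e t < w i e t * w j 0 t" by (intro mult_strict_mono) (auto simp: not_le)
  with ratio[of i j] i j show False by (simp add: mult.commute)
qed

text \<open>Project the relations of bodies 0 and \<open>e\<close> to \<open>E\<close> and add them.
  A third body has equal weights in both, and its two inner products sum to the difference of its
  squared distances, which is zero. Only the mutual terms of 0 and \<open>e\<close> remain.\<close>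

lemma equidistant_imp_shift_eq:
  assumes bal: "balanced a" and e: "0 < e" "e < n"
    and eqd: "\<And>i. i < n \<Longrightarrow> i \<noteq> 0 \<Longrightarrow> i \<noteq> e \<Longrightarrow> norm (x i t - x 0 t) = norm (x i t - x e t)"
  shows "a (l + e) = a l"
proof -
  define E where "E = x e t - x 0 t"
  define r where "r k j = (a (j + l) * w j k t) * ((x j t - x k t) \<bullet> E)" for k j
  have r0: "(\<Sum>j<n. r k j) = 0" for k
  proof -
    have "(\<Sum>j<n. r k j) = (\<Sum>j<n. (a (j + l) * w j k t) *\<^sub>R (x j t - x k t)) \<bullet> E"
      by (simp add: r_def inner_sum_left)
    then show ?thesis by (simp add: balanced_at[OF bal])
  qed
  have other: "r 0 j + r e j = 0" if "j < n" "j \<noteq> 0" "j \<noteq> e" for j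
  proof -
    have "(x j t - x 0 t) \<bullet> E + (x j t - x e t) \<bullet> E
        = (norm (x j t - x 0 t))\<^sup>2 - (norm (x j t - x e t))\<^sup>2"
      by (simp add: E_def power2_norm_eq_inner algebra_simps inner_commute)
    also have "\<dots> = 0" using eqd[OF that] by simp
    finally have "(x j t - x 0 t) \<bullet> E + (x j t - x e t) \<bullet> E = 0" .
    moreover have "w j 0 t = w j e t" using eqd[OF that] by (simp add: w_def)
    ultimately show ?thesis unfolding r_def by (metis distrib_left mult_zero_right)
  qed
  have "0 = (\<Sum>j<n. r 0 j + r e j)" using r0 by (simp add: sum.distrib)
  also have "\<dots> = (\<Sum>j\<in>{0, e}. r 0 j + r e j)"
    using e other by (intro sum.mono_neutral_right) auto
  also have "\<dots> = r 0 e + r e 0" using e by (simp add: r_def)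
  also have "\<dots> = (a (l + e) - a l) * (w e 0 t * (norm E)\<^sup>2)"
    using w_sym[of 0 e t]
    by (simp add: r_def E_def power2_norm_eq_inner algebra_simps inner_commute)
  finally have "(a (l + e) - a l) * (w e 0 t * (norm E)\<^sup>2) = 0" by simp
  moreover have "w e 0 t > 0" using w_pos e by simp
  moreover have "E \<noteq> 0" using collision_free[of e 0 t] e by (auto simp: E_def)
  ultimately show ?thesis by simp
qed

lemma ratio_const_imp_shift_eq:
  assumes bal: "balanced a" and e: "0 < e" "e < n"
    and S: "{0..real n * c} \<subseteq> closure S"
    and ratio: "\<And>t i j. t \<in> S \<Longrightarrow> i < n \<Longrightarrow> j < n \<Longrightarrow> i \<notin> {0, e} \<Longrightarrow> j \<notin> {0, e} \<Longrightarrow>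
      w i 0 t * w j e t = w j 0 t * w i e t"
  shows "a (l + e) = a l"
proof -
  have "S \<subseteq> {t. closer 0 e t} \<union> {t. closer e 0 t}"
    using ratio_const_closer[OF e] ratio by blast
  \<comment> \<open>The union of the two closed conditions contains \<open>S\<close>, hence its
    closure; which of the two holds may depend on the time.\<close>
  then have "closure S \<subseteq> {t. closer 0 e t} \<union> {t. closer e 0 t}"
    by (intro closure_minimal closed_Un closed_closer)
  then have cover: "closer 0 e t \<or> closer e 0 t" if "t \<in> {0..real n * c}" for t
    using S that by auto
  obtain t' where t': "moment e t' = moment 0 t'" using ex_equal_moments by blast
  obtain t where t: "t \<in> {0..real n * c}" "\<And>j. x j t' = x j t" using period_reduce by blast
  have "moment e t = moment 0 t" using t' by (simp add: moment_def t(2))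
  then have "norm (x i t - x 0 t) = norm (x i t - x e t)" if "i < n" "i \<noteq> 0" "i \<noteq> e" for i
    using cover[OF t(1)] closer_equal[of 0 e t i] closer_equal[of e 0 t i] that e by auto
  with equidistant_imp_shift_eq[OF bal e] show ?thesis by blast
qed


section \<open>Configurations of small corank\<close>

lemma rel_other: "i \<noteq> k \<Longrightarrow> rel a k s t i = a (i + s) * w i k t"
  by (simp add: rel_def)

lemma proportional_cross:
  fixes \<alpha> \<beta> u v u' v' :: real
  assumes "\<alpha> \<noteq> 0 \<or> \<beta> \<noteq> 0" "\<alpha> * u + \<beta> * v = 0" "\<alpha> * u' + \<beta> * v' = 0"
  shows "u * v' = u' * v"
proof -
  have "\<alpha> * (u * v' - u' * v) = 0" "\<beta> * (u * v' - u' * v) = 0"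
    using assms(2,3) by algebra+
  then show ?thesis using assms(1) by auto
qed

text \<open>The relations of body 0 say nothing direct about index 0, where the diagonal entry
  stands; the zero sum fills this gap.\<close>

lemma periodic_vanish:
  fixes b :: "nat \<Rightarrow> real"
  assumes "\<And>j. b (j + n) = b j" "(\<Sum>j<n. b j) = 0" "\<And>i. 1 \<le> i \<Longrightarrow> i < n \<Longrightarrow> b i = 0"
  shows "b i = 0"
proof -
  have "(\<Sum>j\<in>{0}. b j) = (\<Sum>j<n. b j)"
    using n2 assms(3) by (intro sum.mono_neutral_left) (auto simp: Suc_le_eq)
  then have "b 0 = 0" using assms(2) by simp
  then have "b (i mod n) = 0" using assms(3)[of "i mod n"] n2 by (cases "i mod n = 0") auto
  then show ?thesis using periodic_mod[of b n i] assms(1) by simp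
qed

lemma periodic_tail_zero:
  fixes b :: "nat \<Rightarrow> real"
  assumes "\<And>j. b (j + n) = b j" "\<And>k. b (i + k) = 0"
  shows "b j = 0"
proof -
  have "i \<le> j + i * n" using n2 by (simp add: trans_le_add2)
  then have "b (j + i * n) = 0" using assms(2)[of "j + i * n - i"] by simp
  moreover have "b ((j + i * n) mod n) = b (j + i * n)" "b (j mod n) = b j"
    by (rule periodic_mod, rule assms(1))+
  ultimately show ?thesis by simp
qed

lemma balanced_periodic_add: "balanced a \<Longrightarrow> a (j + n + s) = a (j + s)"
  using balanced_periodic[of a "j + s"] by (simp add: algebra_simps)

lemma balanced_const_zero:
  assumes "balanced a" "\<And>l. a (l + 1) = a l"
  shows "a i = 0"
proof -
  have "a j = a 0" for j using assms(2) by (induction j) auto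
  moreover have "(\<Sum>j<n. a j) = 0" using assms(1) by (simp add: balanced_def)
  ultimately show ?thesis using n2 by (metis (no_types, lifting) card_lessThan lessThan_empty_iff
      mult_eq_0_iff not_numeral_le_zero of_nat_eq_0_iff sum.cong sum_constant)
qed

lemma recurrence_extends:
  assumes "balanced a" "\<And>i. 1 \<le> i \<Longrightarrow> i < n \<Longrightarrow> \<alpha> * a i + \<beta> * a (i + 1) + \<gamma> * a (i + 2) = 0"
  shows "\<alpha> * a i + \<beta> * a (i + 1) + \<gamma> * a (i + 2) = 0"
proof (rule periodic_vanish[of "\<lambda>i. \<alpha> * a i + \<beta> * a (i + 1) + \<gamma> * a (i + 2)"])
  show "(\<Sum>j<n. \<alpha> * a j + \<beta> * a (j + 1) + \<gamma> * a (j + 2)) = 0"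
    using balanced_sum[OF assms(1), of 0] balanced_sum[OF assms(1), of 1] balanced_sum[OF assms(1), of 2]
    by (simp add: sum.distrib flip: sum_distrib_left)
  show "\<alpha> * a (j + n) + \<beta> * a (j + n + 1) + \<gamma> * a (j + n + 2) = \<alpha> * a j + \<beta> * a (j + 1) + \<gamma> * a (j + 2)" for j
    by (simp only: balanced_periodic_add[OF assms(1)] balanced_periodic[OF assms(1)])
qed (rule assms(2))

text \<open>A nonzero \<open>a\<close> has a constant ratio of consecutive terms, which
  \<open>cyclic_multiplier\<close> restricts to 1 or -1; its square is 1.\<close>

lemma first_order_imp_two_periodic:
  assumes "balanced a" "\<alpha> \<noteq> 0 \<or> \<beta> \<noteq> 0" "\<And>i. \<alpha> * a i + \<beta> * a (i + 1) = 0"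
  shows "a (i + 2) = a i"
proof (cases "\<exists>j. a j \<noteq> 0")
  case True
  then obtain j where j: "a j \<noteq> 0" by blast
  have \<beta>: "\<beta> \<noteq> 0" using assms(2) assms(3)[of j] j by auto
  define \<rho> where "\<rho> = - \<alpha> / \<beta>"
  have rec: "a (i + 1) = \<rho> * a i" for i
    using assms(3)[of i] \<beta> by (simp add: \<rho>_def field_simps eq_neg_iff_add_eq_0)
  have "\<rho> = 1 \<or> \<rho> = -1"
    by (rule cyclic_multiplier[where s = 1, OF _ _ _ rec j])
       (use n2 balanced_periodic[OF assms(1)] in auto)
  then show ?thesis using rec[of i] rec[of "i + 1"] by auto
qed auto

lemma corank1_imp_zero:
  assumes bal: "balanced a" and S: "{0..real n * c} \<subseteq> closure S"
    and rank: "\<And>t. t \<in> S \<Longrightarrow> corank_le t 1"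
  shows "a i = 0"
proof (rule ccontr)
  assume ai: "a i \<noteq> 0"
  have "S \<noteq> {}" using S c_pos by auto
  then obtain t0 where t0: "t0 \<in> S" by blast
  have n0: "0 < n" "1 < n" using n2 by auto
  \<comment> \<open>Two lags of the same body share the weight \<open>w i 0 t0\<close>; cancelling
    it leaves a recurrence for \<open>a\<close> with constant coefficients.\<close>
  obtain \<alpha> \<beta> where ab: "\<alpha> \<noteq> 0 \<or> \<beta> \<noteq> 0"
    "\<And>i. i < n \<Longrightarrow> \<alpha> * rel a 0 0 t0 i + \<beta> * rel a 0 1 t0 i = 0"
    using rel_dependent2[OF bal n0(1) n0(1) rank[OF t0], of 0 1] by blast
  have "\<alpha> * a i + \<beta> * a (i + 1) + 0 * a (i + 2) = 0" for i
  proof (rule recurrence_extends[OF bal])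
    fix i assume i: "1 \<le> i" "i < n"
    have "(\<alpha> * a i + \<beta> * a (i + 1)) * w i 0 t0 = 0"
      using ab(2)[of i] i by (simp add: rel_other algebra_simps)
    then show "\<alpha> * a i + \<beta> * a (i + 1) + 0 * a (i + 2) = 0" using w_pos[of i 0 t0] i by simp
  qed
  then have rec: "\<alpha> * a i + \<beta> * a (i + 1) = 0" for i by simp
  have \<beta>: "\<beta> \<noteq> 0" using ab(1) rec[of i] ai by auto
  \<comment> \<open>Since \<beta> is nonzero, a zero of \<open>a\<close> would propagate forwards
    and, by periodicity, everywhere.\<close>
  have nz: "a j \<noteq> 0" for j
  proof
    assume "a j = 0"
    then have "a (j + k) = 0" for k
    proof (induction k)
      case (Suc k)
      then show ?case using rec[of "j + k"] \<beta> by simp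
    qed simp
    then show False using periodic_tail_zero[of a j i] balanced_periodic[OF bal] ai by blast
  qed
  have "a (l + 1) = a l" for l
  proof (rule ratio_const_imp_shift_eq[OF bal _ _ S])
    fix t i j assume t: "t \<in> S" and ij: "i < n" "j < n" "i \<notin> {0, 1}" "j \<notin> {0, 1}"
    \<comment> \<open>Now two bodies with the same lag: the common factor \<open>a i\<close> is
      nonzero and cancels, leaving proportional weights.\<close>
    obtain \<alpha> \<beta> where ab: "\<alpha> \<noteq> 0 \<or> \<beta> \<noteq> 0"
      "\<And>i. i < n \<Longrightarrow> \<alpha> * rel a 0 0 t i + \<beta> * rel a 1 0 t i = 0"
      using rel_dependent2[OF bal n0 rank[OF t], of 0 0] by blast
    have "\<alpha> * w i 0 t + \<beta> * w i 1 t = 0" if "i < n" "i \<notin> {0, 1}" for i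
    proof -
      have "a i * (\<alpha> * w i 0 t + \<beta> * w i 1 t) = 0"
        using ab(2)[of i] that by (simp add: rel_other algebra_simps)
      then show ?thesis using nz by simp
    qed
    then show "w i 0 t * w j 1 t = w j 0 t * w i 1 t"
      using proportional_cross[OF ab(1)] ij by blast
  qed (use n0 in auto)
  then have "a i = 0" by (rule balanced_const_zero[OF bal])
  with ai show False by blast
qed

text \<open>Done separately because \<open>no_quarter_turn\<close> needs more odd indices. The
  difference \<open>d\<close> changes sign under a shift by two, so the relations of body 0 for two
  consecutive lags combine to a sum of two squares times the nonzero vector
  \<open>z 2\<close>.\<close>

lemma four_bodies:
  assumes bal: "balanced a" and n4: "n = 4"
  shows "a (i + 2) = a i"
proof -
  have p: "a (j + 4) = a j" for j using balanced_periodic[OF bal] n4 by simp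
  define d where "d j = a j - a (j + 2)" for j
  have d2: "d (j + 2) = - d j" for j using p[of j] by (simp add: d_def add.assoc numeral_eq_Suc)
  have "balanced (\<lambda>j. 1 * a (j + 0) + (-1) * a (j + 2))" by (rule balanced_comb[OF bal])
  moreover have "d = (\<lambda>j. 1 * a (j + 0) + (-1) * a (j + 2))" by (simp add: d_def fun_eq_iff)
  ultimately have bd: "balanced d" by simp
  define z where "z j = w j 0 0 *\<^sub>R (x j 0 - x 0 0)" for j
  have "(\<Sum>j<n. (d (j + l) * w j 0 0) *\<^sub>R (x j 0 - x 0 0)) = 0" for l
    by (rule balanced_at[OF bd])
  then have e: "d (l + 1) *\<^sub>R z 1 + d (l + 2) *\<^sub>R z 2 + d (l + 3) *\<^sub>R z 3 = 0" for l
    using n4 by (simp add: z_def numeral_3_eq_3 numeral_2_eq_2 eval_nat_numeral add.commute)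
  have e0: "d (l + 1) *\<^sub>R (z 1 - z 3) = d l *\<^sub>R z 2" for l
    using e[of l] d2[of l] d2[of "l + 1"] by (simp add: algebra_simps eval_nat_numeral)
  have "z 2 \<noteq> 0" using w_pos[of 2 0 0] collision_free[of 2 0 0] n4 by (simp add: z_def)
  have "(d l * d l + d (l + 1) * d (l + 1)) *\<^sub>R z 2 = 0" for l
  proof -
    have "(d l * d l) *\<^sub>R z 2 = (d l * d (l + 1)) *\<^sub>R (z 1 - z 3)"
      using e0[of l] by (metis scaleR_scaleR)
    also have "\<dots> = - (d (l + 1) *\<^sub>R (d (l + 2) *\<^sub>R (z 1 - z 3)))"
      using d2[of l] by (simp add: mult.commute)
    also have "d (l + 2) *\<^sub>R (z 1 - z 3) = d (l + 1) *\<^sub>R z 2"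
      using e0[of "l + 1"] by (simp add: add.assoc)
    finally show ?thesis by (simp add: scaleR_add_left)
  qed
  then have "d i * d i + d (i + 1) * d (i + 1) = 0" using \<open>z 2 \<noteq> 0\<close> by simp
  then have "d i = 0" by (simp add: sum_squares_eq_zero_iff)
  then show ?thesis by (simp add: d_def)
qed

text \<open>The case that escapes the argument with the bodies 0 and 1: their weight ratio may alternate
  with the parity of the third body. Since increments and relations split by parity, the bodies 0
  and 2 can be compared instead.\<close>
lemma no_quarter_turn:
  assumes bal: "balanced a" and S: "{0..real n * c} \<subseteq> closure S"
    and rank: "\<And>t. t \<in> S \<Longrightarrow> corank_le t 2"
    and anti: "\<And>i. a (i + 2) = - a i" and n4: "n \<noteq> 4"
  shows "a i = 0"
proof (rule ccontr)
  assume ai: "a i \<noteq> 0"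
  have pow: "a (j + 2 * k) = (-1) ^ k * a j" for j k
  proof (induction k)
    case (Suc k)
    then show ?case using anti[of "j + 2 * k"] by (simp add: algebra_simps)
  qed simp
  \<comment> \<open>Going round the cycle, twice if \<open>n\<close> is odd, must not change the
    sign; this forces \<open>n\<close> to be a multiple of 4, hence at least 8.\<close>
  have "even n"
  proof (rule ccontr)
    assume "odd n"
    then have "a (i + n + n) = - a i" using pow[of i n] by (simp add: mult_2 add.assoc)
    then show False using balanced_periodic[OF bal] ai by simp
  qed
  then obtain m where m: "n = 2 * m" by blast
  have "even m"
  proof (rule ccontr)
    assume "odd m"
    then have "a (i + n) = - a i" using pow[of i m] m by simp
    then show False using balanced_periodic[OF bal] ai by simp
  qed
  then obtain m' where "m = 2 * m'" by blast
  with m n4 n2 have n8: "n \<ge> 8" by simp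
  \<comment> \<open>the combination that vanishes at odd indices\<close>
  define e where "e j = a 0 * a (j + 0) + a 1 * a (j + 1)" for j
  have bale: "balanced e" unfolding e_def by (rule balanced_comb[OF bal])
  have antie: "e (j + 2) = - e j" for j
    using anti[of j] anti[of "j + 1"] by (simp add: e_def algebra_simps)
  have powe: "e (j + 2 * k) = (-1) ^ k * e j" for j k
  proof (induction k)
    case (Suc k)
    then show ?case using antie[of "j + 2 * k"] by (simp add: algebra_simps)
  qed simp
  have "a 0 \<noteq> 0 \<or> a 1 \<noteq> 0"
  proof (cases "even i")
    case True
    then obtain k where "i = 2 * k" by blast
    then show ?thesis using pow[of 0 k] ai by auto
  next
    case False
    then obtain k where "i = 2 * k + 1" by (auto elim: oddE)
    then show ?thesis using pow[of 1 k] ai by (auto simp: add.commute)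
  qed
  \<comment> \<open>\<open>e 0\<close> is the sum of the squares of \<open>a 0\<close> and
    \<open>a 1\<close>, while in \<open>e 1\<close> the products cancel because
    \<open>a 2 = - a 0\<close>.\<close>
  then have e0: "e 0 > 0" by (auto simp: e_def sum_power2_gt_zero_iff simp flip: power2_eq_square)
  have e1: "e 1 = 0" using anti[of 0] by (simp add: e_def algebra_simps eval_nat_numeral)
  have eodd: "e j = 0" if "odd j" for j
  proof -
    from that obtain k where "j = 1 + 2 * k" by (auto elim: oddE)
    then show ?thesis using powe[of 1 k] e1 by simp
  qed
  have eeven: "e j \<noteq> 0" if "even j" for j
  proof -
    from that obtain k where "j = 0 + 2 * k" by auto
    then show ?thesis using powe[of 0 k] e0 by simp
  qed
  have "e (0 + 2) = e 0"
  proof (rule ratio_const_imp_shift_eq[OF bale _ _ S])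
    fix t i j assume t: "t \<in> S" and ij: "i < n" "j < n" "i \<notin> {0, 2}" "j \<notin> {0, 2}"
    have "1 < n" using n2 by simp
    \<comment> \<open>The relation of body 1 is auxiliary, since corank 2 takes three relations. Its
      lag 1 makes its entries nonzero at odd indices other than 1, where those of \<open>i\<close>
      and \<open>j\<close> vanish off the diagonal; hence \<gamma> drops out.\<close>
    obtain \<alpha> \<beta> \<gamma> where g: "\<alpha> \<noteq> 0 \<or> \<beta> \<noteq> 0 \<or> \<gamma> \<noteq> 0"
      "\<And>k. k < n \<Longrightarrow> \<alpha> * rel e i 0 t k + \<beta> * rel e j 0 t k + \<gamma> * rel e 1 1 t k = 0"
      using rel_dependent3[OF bale ij(1,2) \<open>1 < n\<close> rank[OF t], of 0 0 1] by blast
    \<comment> \<open>Three candidates, all below \<open>n\<close>, of which \<open>i\<close> and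
      \<open>j\<close> exclude at most two.\<close>
    have "\<exists>k\<in>{3, 5, 7}. k \<noteq> i \<and> k \<noteq> j" by auto
    then obtain k where "k \<in> {3, 5, 7}" and k: "k \<noteq> i" "k \<noteq> j" by blast
    then have k': "k \<noteq> 1" "k < n" "odd k" using n8 by auto
    have "\<gamma> * (e (k + 1) * w k 1 t) = 0"
      using g(2)[of k] k k' eodd[of k] by (simp add: rel_other)
    then have "\<gamma> = 0" using w_pos[of k 1 t] k' eeven[of "k + 1"] \<open>1 < n\<close> by simp
    have "e 0 * (\<alpha> * w i 0 t + \<beta> * w j 0 t) = 0"
      using g(2)[of 0] ij \<open>\<gamma> = 0\<close> n8 w_sym[of 0] by (simp add: rel_other algebra_simps)
    moreover have "e 2 * (\<alpha> * w i 2 t + \<beta> * w j 2 t) = 0"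
      using g(2)[of 2] ij \<open>\<gamma> = 0\<close> n8 w_sym[of 2] by (simp add: rel_other algebra_simps flip: numeral_2_eq_2)
    ultimately have "\<alpha> * w i 0 t + \<beta> * w j 0 t = 0" "\<alpha> * w i 2 t + \<beta> * w j 2 t = 0"
      using eeven[of 0] eeven[of 2] by auto
    then show "w i 0 t * w j 2 t = w j 0 t * w i 2 t"
      using proportional_cross[of \<alpha> \<beta> "w i 0 t" "w j 0 t" "w i 2 t" "w j 2 t"] g(1) \<open>\<gamma> = 0\<close>
      by (simp add: mult.commute)
  qed (use n8 in auto)
  with antie[of 0] e0 show False by simp
qed

text \<open>If \<open>a\<close> is not 2-periodic, it satisfies no first-order recurrence, but three
  lags of body 0 give one of second order. With \<sigma> zero, \<open>a\<close> changes sign under a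
  shift by two and \<open>no_quarter_turn\<close> applies; otherwise bodies 0 and 1 have a constant
  weight ratio.\<close>

lemma corank2_imp_two_periodic:
  assumes bal: "balanced a" and S: "{0..real n * c} \<subseteq> closure S"
    and rank: "\<And>t. t \<in> S \<Longrightarrow> corank_le t 2"
  shows "a (i + 2) = a i"
proof (rule ccontr)
  assume ai: "a (i + 2) \<noteq> a i"
  note per = balanced_periodic[OF bal]
  have indep: "\<alpha> = 0 \<and> \<beta> = 0" if "\<And>i. \<alpha> * a i + \<beta> * a (i + 1) = 0" for \<alpha> \<beta>
    using first_order_imp_two_periodic[OF bal, of \<alpha> \<beta> i] that ai by blast
  have small: "n \<noteq> 3"
  proof
    assume n3: "n = 3"
    have "a (l + 1) = a l" for l
    \<comment> \<open>With three bodies there is only one third body, so its weight ratio is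
      trivially constant.\<close>
    proof (rule ratio_const_imp_shift_eq[OF bal _ _ S])
      fix t i j assume "i < n" "j < n" "i \<notin> {0, 1}" "j \<notin> {0, 1}"
      then have "i = j" using n3 by auto
      then show "w i 0 t * w j 1 t = w j 0 t * w i 1 t" by simp
    qed (use n3 in auto)
    from this[of i] this[of "i + 1"] ai show False by simp
  qed
  have "n \<noteq> 2" using per[of i] ai by auto
  with small four_bodies[OF bal, of i] ai n2 have n5: "n \<ge> 5" by force
  have "S \<noteq> {}" using S c_pos by auto
  then obtain t0 where t0: "t0 \<in> S" by blast
  have n0: "0 < n" "1 < n" using n2 by auto
  obtain \<alpha> \<beta> \<gamma> where ab: "\<alpha> \<noteq> 0 \<or> \<beta> \<noteq> 0 \<or> \<gamma> \<noteq> 0"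
    "\<And>i. i < n \<Longrightarrow> \<alpha> * rel a 0 0 t0 i + \<beta> * rel a 0 1 t0 i + \<gamma> * rel a 0 2 t0 i = 0"
    using rel_dependent3[OF bal n0(1) n0(1) n0(1) rank[OF t0], of 0 1 2] by blast
  have lin: "\<alpha> * a i + \<beta> * a (i + 1) + \<gamma> * a (i + 2) = 0" for i
  proof (rule recurrence_extends[OF bal])
    fix i assume i: "1 \<le> i" "i < n"
    have "(\<alpha> * a i + \<beta> * a (i + 1) + \<gamma> * a (i + 2)) * w i 0 t0 = 0"
      using ab(2)[of i] i by (simp add: rel_other algebra_simps)
    then show "\<alpha> * a i + \<beta> * a (i + 1) + \<gamma> * a (i + 2) = 0" using w_pos[of i 0 t0] i by simp
  qed
  have \<gamma>: "\<gamma> \<noteq> 0" using lin indep[of \<alpha> \<beta>] ab(1) by auto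
  define \<sigma> \<tau> where "\<sigma> = - \<beta> / \<gamma>" and "\<tau> = - \<alpha> / \<gamma>"
  have rec: "a (i + 2) = \<sigma> * a (i + 1) + \<tau> * a i" for i
  proof -
    have "\<gamma> * a (i + 2) = - \<beta> * a (i + 1) - \<alpha> * a i" using lin[of i] by simp
    then show ?thesis using \<gamma> by (simp add: \<sigma>_def \<tau>_def field_simps)
  qed
  have \<tau>: "\<tau> \<noteq> 0"
  proof
    assume "\<tau> = 0"
    have "\<sigma> * a i + (-1) * a (i + 1) = 0" for i
    proof -
      \<comment> \<open>Moving up by \<open>n\<close> makes room to apply \<open>rec\<close> one
        index earlier.\<close>
      have "a (i + n + 1) = \<sigma> * a (i + n)"
        using rec[of "i + n - 1"] \<open>\<tau> = 0\<close> n2 by (simp add: Suc_diff_le)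
      then show ?thesis using per[of i] balanced_periodic_add[OF bal, of i 1] by simp
    qed
    from indep[OF this] show False by simp
  qed
  \<comment> \<open>If this determinant vanished, the sequence in \<open>eta\<close>, which obeys
    the recurrence in \<open>k\<close>, would start with two zeros and vanish. That is a first-order
    recurrence for \<open>a\<close> with coefficients \<open>a (i + 1)\<close> and
    \<open>- a i\<close>; by \<open>indep\<close> both are zero, and then so is
    \<open>a\<close>.\<close>
  have det: "a i * a (i + 2) - a (i + 1) * a (i + 1) \<noteq> 0" for i
  proof
    assume 0: "a i * a (i + 2) - a (i + 1) * a (i + 1) = 0"
    have eta: "a (i + 1) * a (i + k) - a i * a (i + k + 1) = 0 \<and>
        a (i + 1) * a (i + k + 1) - a i * a (i + k + 2) = 0" for k
    proof (induction k)
      case 0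
      then show ?case using \<open>a i * a (i + 2) - a (i + 1) * a (i + 1) = 0\<close> by simp
    next
      case (Suc k)
      have r1: "a (i + k + 2) = \<sigma> * a (i + k + 1) + \<tau> * a (i + k)" by (rule rec)
      have r2: "a (i + k + 3) = \<sigma> * a (i + k + 2) + \<tau> * a (i + k + 1)"
        using rec[of "i + k + 1"] by (simp add: eval_nat_numeral)
      have "a (i + 1) * a (i + k + 2) - a i * a (i + k + 3) = 0"
        using Suc r1 r2 by algebra
      then show ?case using Suc by (simp add: eval_nat_numeral)
    qed
    have "a (i + 1) * a j - a i * a (j + 1) = 0" for j
    proof (rule periodic_tail_zero[of "\<lambda>j. a (i + 1) * a j - a i * a (j + 1)" i])
      show "a (i + 1) * a (i + k) - a i * a (i + k + 1) = 0" for k using eta by blast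
    qed (simp only: per balanced_periodic_add[OF bal])
    then have "a (i + 1) = 0 \<and> - a i = 0" by (intro indep) simp
    then have "a (i + k) = 0 \<and> a (i + k + 1) = 0" for k
    proof (induction k)
      case (Suc k)
      then show ?case using rec[of "i + k"] by (simp add: eval_nat_numeral)
    qed simp
    then have "a j = 0" for j using periodic_tail_zero[of a i j] per by blast
    then show False using indep[of 1 0] by simp
  qed
  show False
  proof (cases "\<sigma> = 0")
    case True
    then have rec2: "a (i + 2) = \<tau> * a i" for i using rec by simp
    have "\<exists>j. a j \<noteq> 0" using ai by metis
    then obtain j where j: "a j \<noteq> 0" by blast
    have "\<tau> = 1 \<or> \<tau> = -1"
      by (rule cyclic_multiplier[where s = 2, OF _ _ _ rec2 j]) (use n2 per in auto)
    moreover have "\<tau> \<noteq> 1" using rec2[of i] ai by force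
    ultimately have "a (i + 2) = - a i" for i using rec2[of i] by simp
    then have "a j = 0" using n5 by (intro no_quarter_turn[OF bal S rank]) auto
    with j show False by simp
  next
    case False
    have "a (l + 1) = a l" for l
    proof (rule ratio_const_imp_shift_eq[OF bal _ _ S])
      fix t i j assume t: "t \<in> S" and ij: "i < n" "j < n" "i \<notin> {0, 1}" "j \<notin> {0, 1}"
      define r where "r i = w i 1 t / w i 0 t" for i
      \<comment> \<open>Lags 0 and 1 of body 0 and lag \<open>s\<close> of body 1 are dependent. The
        last has a nonzero coefficient, as otherwise \<open>a\<close> would satisfy a first-order
        recurrence, so \<open>u\<close> and \<open>v\<close> do not depend on \<open>i\<close>. The
        values 0 and 1 of \<open>s\<close> give the two rows of the matrix below.\<close>
      have "\<exists>u v. \<forall>i. 2 \<le> i \<longrightarrow> i < n \<longrightarrow> a (i + s) * r i = u * a i + v * a (i + 1)" for s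
      proof -
        obtain \<alpha> \<beta> \<gamma> where ab: "\<alpha> \<noteq> 0 \<or> \<beta> \<noteq> 0 \<or> \<gamma> \<noteq> 0"
          "\<And>i. i < n \<Longrightarrow> \<alpha> * rel a 0 0 t i + \<beta> * rel a 0 1 t i + \<gamma> * rel a 1 s t i = 0"
          using rel_dependent3[OF bal n0(1) n0(1) n0(2) rank[OF t], of 0 1 s] by blast
        have "\<gamma> \<noteq> 0"
        proof
          assume "\<gamma> = 0"
          have "\<alpha> * a i + \<beta> * a (i + 1) + 0 * a (i + 2) = 0" for i
          proof (rule recurrence_extends[OF bal])
            fix i assume i: "1 \<le> i" "i < n"
            have "(\<alpha> * a i + \<beta> * a (i + 1)) * w i 0 t = 0"
              using ab(2)[of i] i \<open>\<gamma> = 0\<close> by (simp add: rel_other algebra_simps)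
            then show "\<alpha> * a i + \<beta> * a (i + 1) + 0 * a (i + 2) = 0"
              using w_pos[of i 0 t] i by simp
          qed
          with indep[of \<alpha> \<beta>] ab(1) \<open>\<gamma> = 0\<close> show False by simp
        qed
        have "a (i + s) * r i = (- \<alpha> / \<gamma>) * a i + (- \<beta> / \<gamma>) * a (i + 1)" if "2 \<le> i" "i < n" for i
        proof -
          have "\<alpha> * (a i * w i 0 t) + \<beta> * (a (i + 1) * w i 0 t) + \<gamma> * (a (i + s) * w i 1 t) = 0"
            using ab(2)[of i] that by (simp add: rel_other)
          moreover have "w i 1 t = r i * w i 0 t" using w_pos[of i 0 t] that by (simp add: r_def)
          ultimately have "(\<alpha> * a i + \<beta> * a (i + 1) + \<gamma> * (a (i + s) * r i)) * w i 0 t = 0"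
            by (simp add: algebra_simps)
          then have "\<alpha> * a i + \<beta> * a (i + 1) + \<gamma> * (a (i + s) * r i) = 0"
            using w_pos[of i 0 t] that by simp
          then have "\<gamma> * (a (i + s) * r i) = - \<alpha> * a i - \<beta> * a (i + 1)" by simp
          then show ?thesis using \<open>\<gamma> \<noteq> 0\<close> by (simp add: field_simps)
        qed
        then show ?thesis by blast
      qed
      then obtain u v where uv: "\<And>s i. 2 \<le> i \<Longrightarrow> i < n \<Longrightarrow>
          a (i + s) * r i = u s * a i + v s * a (i + 1)" by metis
      \<comment> \<open>\<open>(a i, a (i + 1))\<close> is an eigenvector, with eigenvalue \<open>r i\<close>, of a matrix independent of \<open>i\<close>;
        consecutive ones are independent and the third is a combination of both\<close>
      have step: "r i = r (i + 2) \<and> r (i + 1) = r (i + 2)" if i: "2 \<le> i" "i + 2 < n" for i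
      proof -
        have r1: "a (i + 2) = \<sigma> * a (i + 1) + \<tau> * a i" by (rule rec)
        have r2: "a (i + 3) = \<sigma> * a (i + 2) + \<tau> * a (i + 1)"
          using rec[of "i + 1"] by (simp add: eval_nat_numeral)
        have s0: "a i * r i = u 0 * a i + v 0 * a (i + 1)"
          "a (i + 1) * r (i + 1) = u 0 * a (i + 1) + v 0 * a (i + 2)"
          "a (i + 2) * r (i + 2) = u 0 * a (i + 2) + v 0 * a (i + 3)"
          using uv[of i 0] uv[of "i + 1" 0] uv[of "i + 2" 0] i by (simp_all add: eval_nat_numeral)
        have s1: "a (i + 1) * r i = u 1 * a i + v 1 * a (i + 1)"
          "a (i + 2) * r (i + 1) = u 1 * a (i + 1) + v 1 * a (i + 2)"
          "a (i + 3) * r (i + 2) = u 1 * a (i + 2) + v 1 * a (i + 3)"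
          using uv[of i 1] uv[of "i + 1" 1] uv[of "i + 2" 1] i by (simp_all add: eval_nat_numeral)
        \<comment> \<open>Applying the matrix to the recurrence for the vectors
          \<open>(a i, a (i + 1))\<close> and subtracting \<open>r (i + 2)\<close> times that
          recurrence leaves a combination of two independent vectors with coefficients
          \<open>p\<close> and \<open>q\<close>.\<close>
        define p q where "p = \<sigma> * (r (i + 1) - r (i + 2))" and "q = \<tau> * (r i - r (i + 2))"
        have p1: "a (i + 1) * p + a i * q = 0" unfolding p_def q_def using r1 r2 s0 by algebra
        have p2: "a (i + 2) * p + a (i + 1) * q = 0" unfolding p_def q_def using r1 r2 s1 by algebra
        have "(a i * a (i + 2) - a (i + 1) * a (i + 1)) * p = 0" using p1 p2 by algebra
        moreover have "(a i * a (i + 2) - a (i + 1) * a (i + 1)) * q = 0" using p1 p2 by algebra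
        ultimately have "p = 0" "q = 0" using det[of i] by auto
        then show ?thesis using False \<tau> by (simp add: p_def q_def)
      qed
      have consec: "r (Suc i) = r i" if "2 \<le> i" "Suc i < n" for i
      proof (cases "i + 2 < n")
        case True
        then show ?thesis using step[of i] that by simp
      next
        case False
        \<comment> \<open>The last consecutive pair is reached through the second half of
          \<open>step\<close>, started one index earlier; this uses \<open>n5\<close>.\<close>
        then obtain i' where "i = Suc i'" "2 \<le> i'" using n5 by (cases i) auto
        then show ?thesis using step[of i'] that by (simp add: eval_nat_numeral)
      qed
      have "r (2 + k) = r 2" if "2 + k < n" for k
        using that
      proof (induction k)
        case (Suc k)
        then show ?case using consec[of "2 + k"] by simp
      qed simp
      then have const: "r l = r 2" if "2 \<le> l" "l < n" for l
        using that le_add_diff_inverse[of 2 l] by metis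
      have "2 \<le> i" "2 \<le> j" using ij by auto
      then have "r i = r j" using const[of i] const[of j] ij by simp
      then have "w i 1 t / w i 0 t = w j 1 t / w j 0 t" by (simp only: r_def)
      moreover have "w i 0 t > 0" "w j 0 t > 0" using w_pos ij by auto
      ultimately show "w i 0 t * w j 1 t = w j 0 t * w i 1 t" by (simp add: frac_eq_eq mult.commute)
    qed (use n0 in auto)
    from this[of i] this[of "i + 1"] ai show False by simp
  qed
qed

end

section \<open>Equality of the masses\<close>

text \<open>The two-step difference \<open>b\<close> is constant by \<open>inc\<close>, and its sum
  over a period vanishes, so it is zero.\<close>

lemma two_periodic_of_increments:
  fixes \<mu> :: "nat \<Rightarrow> real"
  assumes n: "n \<ge> 1" and per: "\<And>j. \<mu> (j + n) = \<mu> j"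
    and inc: "\<And>i. \<mu> (i + 3) - \<mu> (i + 2) = \<mu> (i + 1) - \<mu> i"
  shows "\<mu> (i + 2) = \<mu> i"
proof -
  define b where "b j = \<mu> (j + 2) - \<mu> j" for j
  have "b (Suc j) = b j" for j using inc[of j] by (simp add: b_def numeral_eq_Suc)
  then have "b j = b 0" for j by (induction j) auto
  then have const: "b j = b i" for j by metis
  have "(\<Sum>j<n. b j) = 0"
    using sum_periodic_shift[of \<mu> n 2] per by (simp add: b_def sum_subtractf)
  moreover have "(\<Sum>j<n. b j) = (\<Sum>j<n. b i)" by (intro sum.cong refl const)
  ultimately have "real n * b i = 0" by simp
  then show ?thesis using n by (simp add: b_def)
qed

text \<open>A gap would be a nonempty open set disjoint from \<open>S\<close> inside the interval,
  hence of positive measure, while \<open>S\<close> already has measure \<open>P\<close>.\<close>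

lemma full_measure_closure:
  fixes S :: "real set"
  assumes "S \<subseteq> {0..P}" "S \<in> sets lebesgue" "emeasure lebesgue S = ennreal P" "P > 0"
  shows "{0..P} \<subseteq> closure S"
proof -
  have "{0<..<P} \<subseteq> closure S"
  proof (rule ccontr)
    assume not_sub: "\<not> {0<..<P} \<subseteq> closure S"
    define U where "U = {0<..<P} - closure S"
    have U: "open U" "U \<noteq> {}" using not_sub by (auto simp: U_def)
    have mU: "U \<in> sets lebesgue" using U(1) by (simp add: borel_open)
    have "emeasure lebesgue S + emeasure lebesgue U = emeasure lebesgue (S \<union> U)"
      using mU assms(2) closure_subset[of S] by (intro plus_emeasure) (auto simp: U_def)
    also have "\<dots> \<le> emeasure lebesgue {0..P}"
      using assms(1) by (intro emeasure_mono) (auto simp: U_def)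
    also have "\<dots> = ennreal P" using assms(4) by simp
    finally have "ennreal P + emeasure lebesgue U \<le> ennreal P + 0" using assms(3) by simp
    then have "emeasure lebesgue U = 0"
      unfolding ennreal_add_left_cancel_le by simp
    then have "negligible U" using mU by (simp add: negligible_iff_emeasure0)
    with U show False using open_not_negligible by blast
  qed
  then have "closure {0<..<P} \<subseteq> closure S" by (intro closure_minimal) auto
  then show ?thesis using assms(4) by simp
qed

theorem theorem1:
  fixes n :: nat and m :: "nat \<Rightarrow> real" and f :: "real \<Rightarrow> real"
    and q :: "nat \<Rightarrow> real \<Rightarrow> real ^ 'N" and p :: "real \<Rightarrow> real ^ 'N"
    and P :: real and h :: "nat \<Rightarrow> real"
  assumes n2: "n \<ge> 2"
    and mpos: "\<forall>k\<in>{1..n}. m k > 0"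
    and fpos: "\<forall>x>0. f x > 0"
    and fdecr: "\<forall>x y. 0 < x \<longrightarrow> x < y \<longrightarrow> sqrt y * f y < sqrt x * f x"
    and sol: "is_solution n m f q"
    and chor: "choreography n q p P h"
    and eq: "equally_spaced n P h"
  shows "((config_dim n q P (n - 1) \<or> config_dim n q P (n - 2) \<or>
            (odd n \<and> n \<ge> 3 \<and> config_dim n q P (n - 3)))
           \<longrightarrow> (\<forall>i\<in>{1..n}. \<forall>j\<in>{1..n}. m i = m j)) \<and>
         ((even n \<and> n \<ge> 3 \<and> config_dim n q P (n - 3))
           \<longrightarrow> (\<forall>i\<in>{1..n}. \<forall>j\<in>{1..n}. odd i \<and> odd j \<longrightarrow> m i = m j) \<and>
               (\<forall>i\<in>{1..n}. \<forall>j\<in>{1..n}. even i \<and> even j \<longrightarrow> m i = m j))"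
proof -
  obtain c where c: "\<And>k. 1 \<le> k \<Longrightarrow> k < n \<Longrightarrow> h (k + 1) - h k = c" "h 1 + P - h n = c"
    using eq by (auto simp: equally_spaced_def)
  have hk: "h (Suc k) = h 1 + real k * c" if "k < n" for k
    using that
  proof (induction k)
    case (Suc k)
    then show ?case using c(1)[of "Suc k"] by (simp add: algebra_simps)
  qed simp
  have P: "P > 0" and pP: "\<And>t. p (t + P) = p t"
    and q: "\<And>k t. k \<in> {1..n} \<Longrightarrow> q k t = p (t + h k)"
    using chor by (auto simp: choreography_def)
  have Pc: "P = real n * c"
    using hk[of "n - 1"] c(2) n2 by (simp add: of_nat_diff algebra_simps)
  obtain p' p'' where p': "\<And>t. (p has_vector_derivative p' t) (at t)"
    and p'': "\<And>t. (p' has_vector_derivative p'' t) (at t)"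
    using chor by (auto simp: choreography_def C2_fun_def)
  define x where "x j t = p (t + h 1 + real j * c)" for j t
  have qx: "q (Suc j) t = x j t" if "j < n" for j t
    using q[of "Suc j" t] hk[OF that] that by (simp add: x_def algebra_simps)
  have q1: "q j t = x (j - 1) t" if "j \<in> {1..n}" for j t
    using qx[of "j - 1" t] that by (cases j) auto
  interpret equally_spaced_orbit n c f x
  proof
    show "n \<ge> 2" by (rule n2)
    show "c > 0" using P Pc n2 by (simp add: zero_less_mult_iff)
    show "f s > 0" if "s > 0" for s using fpos that by blast
    show "f s' < f s" if "0 < s" "s < s'" for s s'
    proof -
      have "sqrt s * f s' \<le> sqrt s' * f s'"
        using that fpos by (intro mult_right_mono) (auto simp: less_imp_le)
      also have "\<dots> < sqrt s * f s" using fdecr that by blast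
      finally show ?thesis using that by simp
    qed
    have "continuous_on UNIV p"
      using p' by (meson continuous_at_imp_continuous_on has_vector_derivative_continuous)
    then show "continuous_on UNIV (x j)" for j
      unfolding x_def by (rule continuous_on_compose2) (auto intro!: continuous_intros)
    show "x j (t + c) = x (Suc j) t" for j t by (simp add: x_def algebra_simps)
    show "x (j + n) t = x j t" for j t
      using pP[of "t + h 1 + real j * c"] by (simp add: x_def Pc algebra_simps)
    show "x j t \<noteq> x k t" if "j < n" "k < n" "j \<noteq> k" for j k t
    proof -
      have "q (Suc j) t \<noteq> q (Suc k) t" using sol that by (simp add: is_solution_def)
      then show ?thesis using that by (simp add: qx)
    qed
  qed
  \<comment> \<open>The masses with labels from 0, continued periodically like the bodies.\<close>
  define \<mu> where "\<mu> j = m (Suc (j mod n))" for j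
  define a where "a j = \<mu> (j + 1) - \<mu> j" for j
  have mu_per: "\<mu> (j + n) = \<mu> j" for j by (simp add: \<mu>_def)
  have motion: "p'' (t + h 1 + real k * c) = (\<Sum>j<n. (\<mu> j * w j k t) *\<^sub>R (x j t - x k t))"
    if k: "k < n" for k t
  proof -
    have Sk: "Suc k \<in> {1..n}" using k by simp
    obtain v acc where v: "\<And>t. (q (Suc k) has_vector_derivative v t) (at t)"
      "\<And>t. (v has_vector_derivative acc t) (at t)"
      "\<And>t. acc t = (\<Sum>j\<in>{1..n} - {Suc k}.
          (m j * f ((norm (q j t - q (Suc k) t))\<^sup>2)) *\<^sub>R (q j t - q (Suc k) t))"
      using sol Sk unfolding is_solution_def by blast
    define s where "s = h 1 + real k * c"
    have qs: "q (Suc k) = (\<lambda>t. p (t + s))"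
      using q[OF Sk] hk[OF k] by (auto simp: s_def)
    have shifted: "((\<lambda>t. g (t + s)) has_vector_derivative g' (t + s)) (at t)"
      if "\<And>t. (g has_vector_derivative g' t) (at t)" for g :: "real \<Rightarrow> real ^ 'N" and g' t
    proof -
      have "((\<lambda>t. t + s) has_real_derivative 1) (at t)" by (auto intro!: derivative_eq_intros)
      then have "((\<lambda>t. t + s) has_vector_derivative 1) (at t)"
        by (simp only: has_real_derivative_iff_has_vector_derivative)
      from vector_diff_chain_at[OF this, of g "g' (t + s)"] that show ?thesis by (simp add: o_def)
    qed
    have "v t = p' (t + s)" for t
      using v(1)[of t] shifted[OF p', of t] unfolding qs by (rule vector_derivative_unique_at)
    then have "v = (\<lambda>t. p' (t + s))" by blast
    then have "acc t = p'' (t + s)"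
      using v(2)[of t] shifted[OF p'', of t] by (auto intro: vector_derivative_unique_at)
    \<comment> \<open>The term of the body itself may be added, because its difference vector is
      zero.\<close>
    moreover have "acc t = (\<Sum>j\<in>{1..n}. (m j * f ((norm (q j t - q (Suc k) t))\<^sup>2)) *\<^sub>R (q j t - q (Suc k) t))"
      unfolding v(3) by (rule sum.mono_neutral_left) auto
    moreover have "\<dots> = (\<Sum>j<n. (m (Suc j) * f ((norm (q (Suc j) t - q (Suc k) t))\<^sup>2)) *\<^sub>R
        (q (Suc j) t - q (Suc k) t))"
      by (rule sum.reindex_bij_witness[of _ Suc "\<lambda>j. j - 1"]) auto
    moreover have "\<dots> = (\<Sum>j<n. (\<mu> j * w j k t) *\<^sub>R (x j t - x k t))"
      using k by (intro sum.cong refl) (simp add: qx \<mu>_def w_def)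
    ultimately show ?thesis by (simp add: s_def add.assoc)
  qed
  \<comment> \<open>The left side does not depend on \<open>l\<close>: body \<open>l mod n\<close>
    stands at a shifted time where body 0 stands at time \<open>t\<close>, and its equation
    expresses the same acceleration with the masses rotated by \<open>l\<close>.\<close>
  have motion0: "p'' (t + h 1) = (\<Sum>j<n. (\<mu> (j + l) * w j 0 t) *\<^sub>R (x j t - x 0 t))" for l t
  proof -
    define k where "k = l mod n"
    have k: "k < n" using n2 by (simp add: k_def)
    define s where "s = t - real k * c"
    have s: "x j t = x (j + k) s" for j using shift[of j s k] by (simp add: s_def)
    have ws: "w j 0 t = w (j + k) k s" for j by (simp add: w_def s)
    let ?g = "\<lambda>j. (\<mu> j * w j k s) *\<^sub>R (x j s - x k s)"
    have "p'' (t + h 1) = (\<Sum>j<n. ?g j)"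
      using motion[OF k, of s] by (simp add: s_def algebra_simps)
    also have "\<dots> = (\<Sum>j<n. ?g (j + k))"
      by (intro sum_periodic_shift[symmetric]) (simp add: mu_per w_periodic periodic)
    also have "\<dots> = (\<Sum>j<n. (\<mu> (j + l) * w j 0 t) *\<^sub>R (x j t - x 0 t))"
    proof (rule sum.cong[OF refl])
      fix j
      have "\<mu> (j + k) = \<mu> (j + l)" by (simp add: \<mu>_def k_def mod_simps)
      then show "?g (j + k) = (\<mu> (j + l) * w j 0 t) *\<^sub>R (x j t - x 0 t)"
        by (simp only: ws s[symmetric] s[of 0, symmetric, simplified])
    qed
    finally show ?thesis .
  qed
  have bal: "balanced a"
    unfolding balanced_def
  proof (intro conjI allI)
    show "a (j + n) = a j" for j using mu_per[of j] mu_per[of "j + 1"] by (simp add: a_def)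
    show "(\<Sum>j<n. a j) = 0"
      using sum_periodic_shift[of \<mu> n 1] mu_per by (simp add: a_def sum_subtractf)
    fix l t
    \<comment> \<open>Subtract the expressions for the lags \<open>l + 1\<close> and
      \<open>l\<close>.\<close>
    have "(\<Sum>j<n. (a (j + l) * w j 0 t) *\<^sub>R (x j t - x 0 t)) =
        (\<Sum>j<n. (\<mu> (j + (l + 1)) * w j 0 t) *\<^sub>R (x j t - x 0 t)) -
        (\<Sum>j<n. (\<mu> (j + l) * w j 0 t) *\<^sub>R (x j t - x 0 t))"
      by (simp add: a_def left_diff_distrib scaleR_left_diff_distrib sum_subtractf add.assoc)
    also have "\<dots> = 0" by (simp only: motion0[symmetric]) simp
    finally show "(\<Sum>j<n. (a (j + l) * w j 0 t) *\<^sub>R (x j t - x 0 t)) = 0" .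
  qed
  have dense: "\<exists>S. {0..real n * c} \<subseteq> closure S \<and> (\<forall>t\<in>S. corank_le t r)"
    if cd: "config_dim n q P d" and d: "n - 1 \<le> r + d" for d r
  proof -
    obtain S where S: "S \<subseteq> {0..P}" "S \<in> sets lebesgue" "emeasure lebesgue S = ennreal P"
      "\<And>t. t \<in> S \<Longrightarrow> dim (span ((\<lambda>j. q j t - q 1 t) ` {2..n})) = d"
      using cd unfolding config_dim_def by blast
    have "corank_le t r" if "t \<in> S" for t
    proof -
      have "{2..n} = Suc ` {1..<n}"
        by (simp add: image_Suc_atLeastLessThan atLeastLessThanSuc_atLeastAtMost numeral_2_eq_2)
      then have "(\<lambda>j. q j t - q 1 t) ` {2..n} = (\<lambda>j. q (Suc j) t - q (Suc 0) t) ` {1..<n}"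
        by (simp only: image_image One_nat_def)
      also have "\<dots> = (\<lambda>j. x j t - x 0 t) ` {1..<n}"
        using n2 by (intro image_cong refl) (simp add: qx)
      finally show ?thesis using S(4)[OF that] d by (simp add: corank_le_def)
    qed
    moreover have "{0..P} \<subseteq> closure S" using full_measure_closure S(1-3) P by blast
    ultimately show ?thesis using Pc by blast
  qed
  have m_mu: "m i = \<mu> (i - 1)" if "i \<in> {1..n}" for i using that by (cases i) (auto simp: \<mu>_def)
  have all: "\<forall>i\<in>{1..n}. \<forall>j\<in>{1..n}. m i = m j"
    if "config_dim n q P (n - 1) \<or> config_dim n q P (n - 2)"
  proof -
    obtain d where "config_dim n q P d" "n - 1 \<le> 1 + d" using \<open>_ \<or> _\<close> by fastforce
    then obtain S where "{0..real n * c} \<subseteq> closure S" "\<forall>t\<in>S. corank_le t 1"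
      using dense by blast
    then have "a i = 0" for i using corank1_imp_zero[OF bal] by blast
    then have "\<mu> (Suc i) = \<mu> i" for i by (simp add: a_def)
    then have "\<mu> i = \<mu> 0" for i by (induction i) auto
    then show ?thesis using m_mu by metis
  qed
  have two: "\<mu> (i + 2) = \<mu> i" if "n \<ge> 3" "config_dim n q P (n - 3)" for i
  proof (rule two_periodic_of_increments[of n \<mu>])
    have "n - 1 \<le> 2 + (n - 3)" by simp
    from dense[OF that(2) this] obtain S where "{0..real n * c} \<subseteq> closure S" "\<forall>t\<in>S. corank_le t 2"
      by blast
    then have "a (i + 2) = a i" for i using corank2_imp_two_periodic[OF bal] by blast
    then show "\<mu> (i + 3) - \<mu> (i + 2) = \<mu> (i + 1) - \<mu> i" for i
      by (simp add: a_def numeral_eq_Suc)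
  qed (use n2 mu_per in auto)
  have parity: "\<mu> i = \<mu> (i mod 2)" if "n \<ge> 3" "config_dim n q P (n - 3)" for i
    using periodic_mod[of \<mu> 2 i] two[OF that] by simp
  have par: "m i = m j" if "n \<ge> 3" "config_dim n q P (n - 3)" "i \<in> {1..n}" "j \<in> {1..n}" "even i = even j"
    for i j
  proof -
    have "(i - 1) mod 2 = (j - 1) mod 2" using that(3-5) by (cases i; cases j) (auto simp: mod_2_eq_odd)
    then show ?thesis using that m_mu parity[OF that(1,2)] by metis
  qed
  have odd_case: "\<forall>i\<in>{1..n}. \<forall>j\<in>{1..n}. m i = m j"
    if "odd n" "n \<ge> 3" "config_dim n q P (n - 3)"
  proof -
    \<comment> \<open>For odd \<open>n\<close> the index \<open>n\<close> is odd but represents body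
      0, which joins the two parity classes.\<close>
    have "\<mu> 1 = \<mu> 0" using mu_per[of 0] parity[OF that(2,3), of n] that(1) by (simp add: mod_2_eq_odd)
    then have "\<mu> i = \<mu> 0" for i using parity[OF that(2,3), of i] by (cases "even i") (auto simp: mod_2_eq_odd)
    then show ?thesis using m_mu by metis
  qed
  show ?thesis using all odd_case par by blast
qed

end
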